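(* Let $n\ge 3$, let $\Gamma$ be a cubic graph embedded in a closed orientable surface $S$, and let $f$ be a nowhere-identity $D_{2n}$-flow of this embedded graph. If all reflection cycles with respect to $f$ are non-zero and contractible on $S$, then $\Gamma$ admits a nowhere-zero $n$-flow.
   Context: Graphs are finite and connected and may have loops and parallel edges; cubic means every vertex has degree $3$. An embedded graph is a graph $\Gamma=(V,E)$ with a rotation system $\pi=\{\pi_v\mid v\in V\}$, where $\pi_v$ is a cyclic order of the edges incident with $v$ (a loop appears twice); equivalently, a cellular embedding of $\Gamma$ in a closed connected orientable surface $S$. For a group $G$ and an orientation of the edges, a $G$-flow is a map $f:E\to G$ such that at each vertex $v$ the product of the values of the incident edges, taken in the order $\pi_v$, is the identity, where the inverse $f(e)^{-1}$ is used for an edge leaving $v$. It is nowhere-identity if $f(e)\neq1$ for all $e$. $D_{2n}=\{\begin{pmatrix}\pm1&a\\0&1\end{pmatrix}\mid a\in\mathbb{Z}/n\mathbb{Z}\}$, with $r=\begin{pmatrix}1&1\\0&1\end{pmatrix}$ and $s=\begin{pmatrix}-1&0\\0&1\end{pmatrix}$; elements of $\langle r\rangle$ are rotations, the other elements are reflections. For a nowhere-identity $D_{2n}$-flow $f$ on an embedded cubic graph, the edges on which $f$ evaluates to a reflection form a $2$-regular (possibly empty) subgraph; its connected components are the reflection cycles with respect to $f$. A reflection cycle is non-zero if $f(e)\ne s$ for each of its edges $e$. A closed curve in $S$ is contractible if it is homotopic to a constant map. A nowhere-zero $n$-flow is a $\mathbb{Z}$-flow (Kirchhoff's law with respect to some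 orientation) with values in $\{\pm1,\dots,\pm(n-1)\}$. *)

theory Defs
  imports
    "HOL-Analysis.Analysis"
    "HOL-Algebra.Generated_Groups"
    "HOL-Combinatorics.Orbits"
    "Graph_Theory.Graph_Theory"
begin

section \<open>Embedded graphs\<close>

text \<open>
  An undirected multigraph is given by its darts (half-edges): every edge is a pair
  \<open>{a, arev a}\<close> of opposite arcs of a bidirected digraph, and the dart \<open>a\<close> is the end of that
  edge at \<open>tail G a\<close>. A loop contributes two distinct darts at its vertex, so \<open>out_degree\<close> is the
  degree of the undirected graph. The rotation system \<open>rot\<close> sends a dart to the next one in the
  cyclic order at its tail.
\<close>

locale embedded_graph =
  fin_digraph G + bidirected_digraph G arev
  for G :: "('a, 'b) pre_digraph" and arev :: "'b \<Rightarrow> 'b" +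
  fixes rot :: "'b \<Rightarrow> 'b"
  assumes connected: "Digraph_Component.connected G"
    and rot_cyclic: "\<And>v. v \<in> verts G \<Longrightarrow> out_arcs G v \<noteq> {} \<Longrightarrow> cyclic_on rot (out_arcs G v)"

definition cubic :: "('a, 'b) pre_digraph \<Rightarrow> bool" where
  "cubic G \<longleftrightarrow> (\<forall>v\<in>verts G. out_degree G v = 3)"

definition dart_edge :: "('b \<Rightarrow> 'b) \<Rightarrow> 'b \<Rightarrow> 'b set" where
  "dart_edge arev a = {a, arev a}"

definition edges :: "('a, 'b) pre_digraph \<Rightarrow> ('b \<Rightarrow> 'b) \<Rightarrow> 'b set set" where
  "edges G arev = dart_edge arev ` arcs G"

text \<open>An orientation picks, for each edge, the dart that points from its tail to its head.\<close>

definition orientation :: "('a, 'b) pre_digraph \<Rightarrow> ('b \<Rightarrow> 'b) \<Rightarrow> 'b set \<Rightarrow> bool" where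
  "orientation G arev ori \<longleftrightarrow>
     ori \<subseteq> arcs G \<and> (\<forall>a\<in>arcs G. (a \<in> ori) \<noteq> (arev a \<in> ori))"


section \<open>Flows\<close>

text \<open>
  The contribution of the dart \<open>a\<close> to the product at \<open>tail G a\<close>: the edge leaves that vertex along
  \<open>a\<close> iff \<open>a \<in> ori\<close>, and otherwise it enters it there.
\<close>

definition dart_value ::
    "('g, 'm) monoid_scheme \<Rightarrow> ('b \<Rightarrow> 'b) \<Rightarrow> 'b set \<Rightarrow> ('b set \<Rightarrow> 'g) \<Rightarrow> 'b \<Rightarrow> 'g" where
  "dart_value A arev ori f a =
     (if a \<in> ori then inv\<^bsub>A\<^esub> (f (dart_edge arev a)) else f (dart_edge arev a))"

text \<open>
  The product at a vertex is taken from every possible starting dart; in a group all these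
  conditions are equivalent.
\<close>

definition group_flow ::
    "('g, 'm) monoid_scheme \<Rightarrow> ('a, 'b) pre_digraph \<Rightarrow> ('b \<Rightarrow> 'b) \<Rightarrow> ('b \<Rightarrow> 'b) \<Rightarrow> 'b set
      \<Rightarrow> ('b set \<Rightarrow> 'g) \<Rightarrow> bool" where
  "group_flow A G arev rot ori f \<longleftrightarrow>
     f \<in> edges G arev \<rightarrow> carrier A \<and>
     (\<forall>v\<in>verts G. \<forall>a\<in>out_arcs G v.
        foldr (mult A) (map (\<lambda>k. dart_value A arev ori f ((rot ^^ k) a)) [0..<out_degree G v]) \<one>\<^bsub>A\<^esub>
          = \<one>\<^bsub>A\<^esub>)"

definition nowhere_identity ::
    "('g, 'm) monoid_scheme \<Rightarrow> ('a, 'b) pre_digraph \<Rightarrow> ('b \<Rightarrow> 'b) \<Rightarrow> ('b set \<Rightarrow> 'g) \<Rightarrow> bool" where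
  "nowhere_identity A G arev f \<longleftrightarrow> (\<forall>e\<in>edges G arev. f e \<noteq> \<one>\<^bsub>A\<^esub>)"

definition kirchhoff ::
    "('a, 'b) pre_digraph \<Rightarrow> ('b \<Rightarrow> 'b) \<Rightarrow> 'b set \<Rightarrow> ('b set \<Rightarrow> int) \<Rightarrow> bool" where
  "kirchhoff G arev ori g \<longleftrightarrow>
     (\<forall>v\<in>verts G. (\<Sum>a\<in>in_arcs G v \<inter> ori. g (dart_edge arev a))
                 = (\<Sum>a\<in>out_arcs G v \<inter> ori. g (dart_edge arev a)))"

definition has_nowhere_zero_flow :: "('a, 'b) pre_digraph \<Rightarrow> ('b \<Rightarrow> 'b) \<Rightarrow> nat \<Rightarrow> bool" where
  "has_nowhere_zero_flow G arev n \<longleftrightarrow>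
     (\<exists>ori g. orientation G arev ori \<and> kirchhoff G arev ori g \<and>
        (\<forall>e\<in>edges G arev. 1 \<le> \<bar>g e\<bar> \<and> \<bar>g e\<bar> \<le> int n - 1))"


section \<open>Dihedral groups\<close>

text \<open>
  The pair \<open>(d, a)\<close> with \<open>d = \<plusminus>1\<close> stands for the matrix with rows \<open>(d, a)\<close> and \<open>(0, 1)\<close> over the
  integers modulo \<open>n\<close>, whose elements are represented by \<open>0, \<dots>, n - 1\<close>. (The signs are
  distinct modulo \<open>n\<close> for \<open>n \<ge> 3\<close>.)
\<close>

definition dihedral :: "nat \<Rightarrow> (int \<times> int) monoid" where
  "dihedral n =
     \<lparr> carrier = {1, -1} \<times> {0..<int n},
       monoid.mult = (\<lambda>(d, a) (d', a'). (d * d', (d * a' + a) mod int n)),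
       one = (1, 0) \<rparr>"

definition dihedral_r :: "int \<times> int" where "dihedral_r = (1, 1)"

definition dihedral_s :: "int \<times> int" where "dihedral_s = (-1, 0)"

definition rotations :: "nat \<Rightarrow> (int \<times> int) set" where
  "rotations n = generate (dihedral n) {dihedral_r}"

definition reflections :: "nat \<Rightarrow> (int \<times> int) set" where
  "reflections n = carrier (dihedral n) - rotations n"

lemma group_dihedral:
  assumes "n > 0"
  shows "group (dihedral n)"
proof (rule groupI)
  show "\<one>\<^bsub>dihedral n\<^esub> \<in> carrier (dihedral n)"
    using assms by (simp add: dihedral_def)
  fix x assume x: "x \<in> carrier (dihedral n)"
  then show "\<one>\<^bsub>dihedral n\<^esub> \<otimes>\<^bsub>dihedral n\<^esub> x = x"
    by (auto simp: dihedral_def)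
  show "\<exists>y\<in>carrier (dihedral n). y \<otimes>\<^bsub>dihedral n\<^esub> x = \<one>\<^bsub>dihedral n\<^esub>"
  proof
    let ?y = "(fst x, (- fst x * snd x) mod int n)"
    show "?y \<in> carrier (dihedral n)"
      using assms x by (auto simp: dihedral_def)
    show "?y \<otimes>\<^bsub>dihedral n\<^esub> x = \<one>\<^bsub>dihedral n\<^esub>"
      using x by (auto simp: dihedral_def mod_simps)
  qed
  fix y assume y: "y \<in> carrier (dihedral n)"
  show "x \<otimes>\<^bsub>dihedral n\<^esub> y \<in> carrier (dihedral n)"
    using assms x y by (auto simp: dihedral_def)
  fix z assume z: "z \<in> carrier (dihedral n)"
  show "x \<otimes>\<^bsub>dihedral n\<^esub> y \<otimes>\<^bsub>dihedral n\<^esub> z = x \<otimes>\<^bsub>dihedral n\<^esub> (y \<otimes>\<^bsub>dihedral n\<^esub> z)"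
    using x y z by (auto simp: dihedral_def mod_simps algebra_simps)
qed


section \<open>The surface of a rotation system\<close>

definition quotient_topology :: "'x topology \<Rightarrow> ('x \<Rightarrow> 'y) \<Rightarrow> 'y topology" where
  "quotient_topology X q =
     topology (\<lambda>U. U \<subseteq> q ` topspace X \<and> openin X {x \<in> topspace X. q x \<in> U})"

lemma istopology_quotient:
  "istopology (\<lambda>U. U \<subseteq> q ` topspace X \<and> openin X {x \<in> topspace X. q x \<in> U})"
proof -
  have 1: "{x \<in> topspace X. q x \<in> S \<inter> T} =
      {x \<in> topspace X. q x \<in> S} \<inter> {x \<in> topspace X. q x \<in> T}" for S T
    by auto
  have 2: "{x \<in> topspace X. q x \<in> \<Union>\<K>} = (\<Union>K\<in>\<K>. {x \<in> topspace X. q x \<in> K})" for \<K>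
    by auto
  show ?thesis
    unfolding istopology_def 1 2 by blast
qed

lemma openin_quotient_topology:
  "openin (quotient_topology X q) U \<longleftrightarrow>
     U \<subseteq> q ` topspace X \<and> openin X {x \<in> topspace X. q x \<in> U}"
  by (simp add: quotient_topology_def istopology_quotient)

lemma topspace_quotient_topology: "topspace (quotient_topology X q) = q ` topspace X"
proof -
  have "{x \<in> topspace X. q x \<in> q ` topspace X} = topspace X"
    by auto
  then have "openin (quotient_topology X q) (q ` topspace X)"
    by (simp add: openin_quotient_topology)
  then show ?thesis
    by (metis openin_quotient_topology openin_subset openin_topspace subset_antisym)
qed

lemma quotient_map_quotient_topology: "quotient_map X (quotient_topology X q) q"
  by (simp add: quotient_map_def topspace_quotient_topology openin_quotient_topology)

text \<open>
  The faces of the embedding are polygons whose sides, in boundary order, are the darts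
  \<open>a, rot (arev a), rot (arev (rot (arev a))), \<dots>\<close> of an orbit of \<open>rot \<circ> arev\<close>.
  Each polygon is cut into triangles from its centre, one triangle for every side. In the triangle
  of the dart \<open>a\<close> the point \<open>(x, y)\<close> has weight \<open>1 - x - y\<close> at the tail of \<open>a\<close>, weight \<open>x\<close> at the
  head of \<open>a\<close> and weight \<open>y\<close> at the centre of the face.
\<close>

definition triangle :: "(real \<times> real) set" where
  "triangle = {(x, y). 0 \<le> x \<and> 0 \<le> y \<and> x + y \<le> 1}"

text \<open>
  The rule \<open>edge\<close> glues the two polygon sides belonging to the same edge, and \<open>spoke\<close> glues
  consecutive triangles of the same polygon. Together they identify the three sides of all the
  triangles in pairs, so that the quotient is a closed surface; it contains the graph as the image
  of the sides \<open>y = 0\<close>, and the interiors of the polygons are its faces. Since every gluing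
  reverses the orientation of the boundary sides, the surface is orientable.
\<close>

inductive glue ::
    "('a, 'b) pre_digraph \<Rightarrow> ('b \<Rightarrow> 'b) \<Rightarrow> ('b \<Rightarrow> 'b)
      \<Rightarrow> 'b \<times> real \<times> real \<Rightarrow> 'b \<times> real \<times> real \<Rightarrow> bool"
  for G arev rot where
  edge: "a \<in> arcs G \<Longrightarrow> 0 \<le> x \<Longrightarrow> x \<le> 1 \<Longrightarrow>
           glue G arev rot (a, x, 0) (arev a, 1 - x, 0)"
| spoke: "a \<in> arcs G \<Longrightarrow> 0 \<le> y \<Longrightarrow> y \<le> 1 \<Longrightarrow>
           glue G arev rot (a, 1 - y, y) (rot (arev a), 0, y)"

definition surface_point ::
    "('a, 'b) pre_digraph \<Rightarrow> ('b \<Rightarrow> 'b) \<Rightarrow> ('b \<Rightarrow> 'b) \<Rightarrow> 'b \<times> real \<times> real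
      \<Rightarrow> ('b \<times> real \<times> real) set" where
  "surface_point G arev rot p = {q. equivclp (glue G arev rot) p q}"

definition surface ::
    "('a, 'b) pre_digraph \<Rightarrow> ('b \<Rightarrow> 'b) \<Rightarrow> ('b \<Rightarrow> 'b) \<Rightarrow> ('b \<times> real \<times> real) set topology" where
  "surface G arev rot =
     quotient_topology (sum_topology (\<lambda>_. top_of_set triangle) (arcs G))
       (surface_point G arev rot)"

text \<open>
  The closed curve, parametrised by \<open>{0..1}\<close>, that runs through the darts of a closed walk \<open>p\<close> at
  constant speed. The reduction modulo \<open>length p\<close> only concerns the end point \<open>t = 1\<close>.
\<close>

definition walk_curve ::
    "('a, 'b) pre_digraph \<Rightarrow> ('b \<Rightarrow> 'b) \<Rightarrow> ('b \<Rightarrow> 'b) \<Rightarrow> 'b list \<Rightarrow> real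
      \<Rightarrow> ('b \<times> real \<times> real) set" where
  "walk_curve G arev rot p t =
     (let u = real (length p) * t
      in surface_point G arev rot (p ! (nat \<lfloor>u\<rfloor> mod length p), frac u, 0))"

text \<open>
  Free homotopy through closed curves, as in \<^const>\<open>homotopic_loops\<close> but for an abstract topology.
\<close>

definition contractible_loop :: "'x topology \<Rightarrow> (real \<Rightarrow> 'x) \<Rightarrow> bool" where
  "contractible_loop X \<gamma> \<longleftrightarrow>
     (\<exists>c. homotopic_with (\<lambda>h. h 0 = h 1) (top_of_set {0..1}) X \<gamma> (\<lambda>_. c))"


section \<open>Reflection cycles\<close>

definition reflection_subgraph ::
    "nat \<Rightarrow> ('a, 'b) pre_digraph \<Rightarrow> ('b \<Rightarrow> 'b) \<Rightarrow> ('b set \<Rightarrow> int \<times> int) \<Rightarrow> ('a, 'b) pre_digraph" where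
  "reflection_subgraph n G arev f =
     (let R = {a \<in> arcs G. f (dart_edge arev a) \<in> reflections n}
      in \<lparr> verts = tail G ` R, arcs = R, tail = tail G, head = head G \<rparr>)"

definition reflection_cycle ::
    "nat \<Rightarrow> ('a, 'b) pre_digraph \<Rightarrow> ('b \<Rightarrow> 'b) \<Rightarrow> ('b set \<Rightarrow> int \<times> int)
      \<Rightarrow> ('a, 'b) pre_digraph \<Rightarrow> bool" where
  "reflection_cycle n G arev f H \<longleftrightarrow>
     pre_digraph.max_subgraph (reflection_subgraph n G arev f) Digraph_Component.connected H"

definition nonzero_cycle ::
    "('b \<Rightarrow> 'b) \<Rightarrow> ('b set \<Rightarrow> int \<times> int) \<Rightarrow> ('a, 'b) pre_digraph \<Rightarrow> bool" where
  "nonzero_cycle arev f H \<longleftrightarrow> (\<forall>e\<in>edges H arev. f e \<noteq> dihedral_s)"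

text \<open>
  \<open>p\<close> runs once around the cycle \<open>H\<close>, using exactly one of the two darts of each of its edges.
  The last condition is needed because a closed walk \<open>[a, arev a]\<close> is a cycle of the digraph.
\<close>

definition traverses :: "('b \<Rightarrow> 'b) \<Rightarrow> ('a, 'b) pre_digraph \<Rightarrow> 'b list \<Rightarrow> bool" where
  "traverses arev H p \<longleftrightarrow>
     pre_digraph.cycle H p \<and> set p \<union> arev ` set p = arcs H \<and> set p \<inter> arev ` set p = {}"

text \<open>
  The traversals of a cycle differ only in starting point and direction, which does not affect
  contractibility.
\<close>

definition contractible_cycle ::
    "('a, 'b) pre_digraph \<Rightarrow> ('b \<Rightarrow> 'b) \<Rightarrow> ('b \<Rightarrow> 'b) \<Rightarrow> ('a, 'b) pre_digraph \<Rightarrow> bool" where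
  "contractible_cycle G arev rot H \<longleftrightarrow>
     (\<exists>p. traverses arev H p \<and>
          contractible_loop (surface G arev rot) (walk_curve G arev rot p))"

end

theory Submission
  imports Defs "HOL-Complex_Analysis.Complex_Analysis"
begin

text \<open>
  A contractible reflection cycle is homologous to zero, so it is the boundary of an integer
  combination of faces; modulo 2, and added up over all reflection cycles, this gives a 2-colouring
  of the faces such that an edge is a reflection iff its two sides have different colours.
  Conjugating the flow by \<open>s\<close> on the faces of one colour turns it into a flow whose values are all
  rotations, and a value becomes the identity only if it was the identity or \<open>s\<close>. This is
  a nowhere-zero flow modulo \<open>n\<close>, and Tutte's theorem yields a nowhere-zero \<open>n\<close>-flow.

  Homological triviality comes from intersection numbers: every closed walk \<open>w\<close> in the dual graph
  is an integer cocycle, hence induces a map from the surface to the circle, whose degree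
  along a contractible curve is zero. So the signed number of crossings of the cycle with \<open>w\<close>
  vanishes, and crossing numbers with the cycle define a potential on the faces.
\<close>

section \<open>Integer cocycles and contractible walks\<close>

lemma equivclp_invariant:
  assumes "equivclp r p q" and "\<And>p q. r p q \<Longrightarrow> g p = g q"
  shows "g p = g q"
  using assms(1) by (induction rule: equivclp_induct) (auto dest: assms(2))

text \<open>Universal property of the gluing: \<open>h\<close> evaluates \<open>g\<close> at an
  arbitrary representative of a class. This is well defined because invariance under
  \<open>glue\<close> extends to its equivalence closure, and continuity descends along the quotient
  map.\<close>

lemma continuous_map_surface:
  assumes cont: "\<And>a. a \<in> arcs G \<Longrightarrow> continuous_map (top_of_set triangle) Y (\<lambda>z. g (a, z))"
    and glued: "\<And>p q. glue G arev rot p q \<Longrightarrow> g p = g q"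
  obtains h where "continuous_map (surface G arev rot) Y h"
    and "\<And>p. h (surface_point G arev rot p) = g p"
proof
  define h where "h C = g (SOME p. p \<in> C)" for C
  show h: "h (surface_point G arev rot p) = g p" for p
  proof -
    have "p \<in> surface_point G arev rot p"
      by (simp add: surface_point_def)
    then have "(SOME q. q \<in> surface_point G arev rot p) \<in> surface_point G arev rot p"
      by (rule someI)
    then have "equivclp (glue G arev rot) p (SOME q. q \<in> surface_point G arev rot p)"
      by (simp add: surface_point_def)
    from equivclp_invariant[OF this, of g] glued show ?thesis
      unfolding h_def by metis
  qed
  let ?X = "sum_topology (\<lambda>_. top_of_set triangle) (arcs G)"
  have "continuous_map ?X Y g"
    unfolding continuous_map_def
  proof (intro conjI allI impI)
    show "g \<in> topspace ?X \<rightarrow> topspace Y"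
      using cont by (fastforce simp: continuous_map_def Pi_iff)
    fix U assume U: "openin Y U"
    have "{z. (a, z) \<in> {x \<in> topspace ?X. g x \<in> U}} = {z \<in> triangle. g (a, z) \<in> U}"
      if "a \<in> arcs G" for a
      using that by auto
    with cont U show "openin ?X {x \<in> topspace ?X. g x \<in> U}"
      by (auto simp: openin_sum_topology continuous_map_def)
  qed
  moreover have "h \<circ> surface_point G arev rot = g"
    using h by auto
  ultimately have "continuous_map ?X Y (h \<circ> surface_point G arev rot)"
    by simp
  with quotient_map_quotient_topology show "continuous_map (surface G arev rot) Y h"
    unfolding surface_def by (rule continuous_compose_quotient_map)
qed

lemma cis_2pi_int [simp]: "cis (2 * pi * of_int m) = 1"
  by (simp add: cis_multiple_2pi)

lemma cis_add_2pi_int [simp]: "cis (2 * pi * (of_int m + x)) = cis (2 * pi * x)"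
  by (simp add: distrib_left flip: cis_mult)

text \<open>A null-homotopic loop has winding number zero, hence a closed continuous logarithm
  \<open>q\<close>. The difference \<open>d\<close> of \<open>q / (2 * pi * \<i>)\<close> and
  \<open>\<theta>\<close> is continuous and integer-valued, so constant, and \<open>\<theta>\<close>
  closes up because \<open>q\<close> does.\<close>

lemma null_homotopic_cis_lift:
  assumes null: "homotopic_loops (- {0}) (\<lambda>t. cis (2 * pi * \<theta> t)) (\<lambda>_. c)"
    and cont: "continuous_on {0..1} \<theta>"
  shows "\<theta> 1 = \<theta> 0"
proof -
  define \<gamma> where "\<gamma> t = cis (2 * pi * \<theta> t)" for t
  have null': "homotopic_loops (- {0}) \<gamma> (\<lambda>_. c)"
    using null unfolding \<gamma>_def .
  have \<gamma>: "path \<gamma>" "0 \<notin> path_image \<gamma>"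
    using homotopic_loops_imp_path[OF null'] homotopic_loops_imp_subset[OF null'] by auto
  have "winding_number \<gamma> 0 = 0"
    using winding_number_homotopic_loops_null_eq[OF \<gamma>] null' by blast
  with winding_number_as_continuous_log[OF \<gamma>] obtain q where q: "path q"
    "pathfinish q = pathstart q" "\<And>t. t \<in> {0..1} \<Longrightarrow> \<gamma> t = exp (q t)"
    by auto
  define d where "d t = q t / (2 * pi * \<i>) - of_real (\<theta> t)" for t
  have "continuous_on {0..1} d"
    unfolding d_def using q(1) cont by (auto simp: path_def intro!: continuous_intros)
  moreover have d_Ints: "d t \<in> \<int>" if t: "t \<in> {0..1}" for t
  proof -
    have "exp (q t) = exp (\<i> * of_real (2 * pi * \<theta> t))"
      using q(3)[OF t] by (simp add: \<gamma>_def cis_conv_exp)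
    then obtain m :: int where "q t = \<i> * of_real (2 * pi * \<theta> t) + of_int (2 * m) * pi * \<i>"
      by (auto simp: exp_eq)
    then have "d t = of_int m"
      by (simp add: d_def field_simps)
    then show ?thesis by simp
  qed
  ultimately have "d constant_on {0..1}"
  proof (intro continuous_discrete_range_constant)
    fix x :: real assume x: "x \<in> {0..1}"
    show "\<exists>e>0. \<forall>y. y \<in> {0..1} \<and> d y \<noteq> d x \<longrightarrow> e \<le> norm (d y - d x)"
    proof (intro exI[of _ 1] conjI allI impI)
      fix y assume "y \<in> {0..1} \<and> d y \<noteq> d x"
      then have "d y - d x \<in> \<int>" "d y - d x \<noteq> 0"
        using d_Ints x by auto
      then obtain m :: int where "d y - d x = of_int m" "m \<noteq> 0"
        by (metis Ints_cases of_int_0)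
      then show "1 \<le> norm (d y - d x)"
        by simp
    qed auto
  qed auto
  then have "d 1 = d 0"
    by (metis constant_on_def atLeastAtMost_iff order_refl zero_le_one)
  with q(2) show ?thesis
    by (simp add: d_def pathfinish_def pathstart_def)
qed

text \<open>
  An integer cocycle, with values \<open>\<phi>\<close> on the darts and \<open>\<psi>\<close> on the spokes, integrates to a map from
  the surface to the circle, and the degree of this map along the walk is the sum of \<open>\<phi>\<close>.
\<close>

lemma contractible_walk_sum_eq_0:
  fixes \<phi> \<psi> :: "'b \<Rightarrow> int"
  assumes antisym: "\<And>a. a \<in> arcs G \<Longrightarrow> \<phi> (arev a) = - \<phi> a"
    and spokes: "\<And>a. a \<in> arcs G \<Longrightarrow> \<psi> (rot (arev a)) = \<psi> a + \<phi> a"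
    and p: "p \<noteq> []"
    and contr: "contractible_loop (surface G arev rot) (walk_curve G arev rot p)"
  shows "(\<Sum>a\<leftarrow>p. \<phi> a) = 0"
proof -
  \<comment> \<open>Under \<open>cis\<close> stands the affine function with value
    \<open>\<psi> a\<close> at the tail, \<open>\<psi> a + \<phi> a\<close> at the head and 0 at the
    centre of the face. It agrees exactly across spokes, and across edges up to an integer, which
    \<open>cis\<close> does not see.\<close>
  define g :: "'b \<times> real \<times> real \<Rightarrow> complex" where
    "g = (\<lambda>(a, x, y). cis (2 * pi * (of_int (\<psi> a) * (1 - y) + of_int (\<phi> a) * x)))"
  have cont: "continuous_map (top_of_set triangle) (top_of_set (- {0})) (\<lambda>z. g (a, z))" for a
  proof -
    have "continuous_on triangle (\<lambda>z. g (a, z))"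
      unfolding g_def split_beta fst_conv snd_conv by (intro continuous_intros)
    then show ?thesis
      by (auto simp: continuous_map_in_subtopology g_def split: prod.splits)
  qed
  have glued: "g q = g q'" if "glue G arev rot q q'" for q q'
    using that
  proof cases
    case (edge a x)
    have "cis (2 * pi * (\<psi> a + \<phi> a * x)) = cis (2 * pi * (\<phi> a * x))"
      by (rule cis_add_2pi_int)
    also have "\<dots> = cis (2 * pi * (of_int (\<psi> (arev a) - \<phi> a) + \<phi> a * x))"
      by (rule cis_add_2pi_int [symmetric])
    finally show ?thesis
      using edge antisym by (simp add: g_def algebra_simps)
  next
    case (spoke a y)
    then show ?thesis
      by (simp add: g_def spokes algebra_simps)
  qed
  obtain h where h: "continuous_map (surface G arev rot) (top_of_set (- {0})) h"
    "\<And>q. h (surface_point G arev rot q) = g q"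
    using continuous_map_surface[OF cont glued] by metis
  define L where "L = length p"
  \<comment> \<open>The clamped factor is the portion of the dart \<open>p ! k\<close> covered by
    time \<open>t\<close>, so \<open>\<theta>\<close> integrates \<open>\<phi>\<close> continuously
    along the walk.\<close>
  define \<theta> :: "real \<Rightarrow> real" where
    "\<theta> t = (\<Sum>k<L. real_of_int (\<phi> (p ! k)) * max 0 (min 1 (real L * t - real k)))" for t
  have L: "L > 0"
    using p by (simp add: L_def)
  have \<theta>_walk: "h (walk_curve G arev rot p t) = cis (2 * pi * \<theta> t)" if t: "t \<in> {0..1}" for t
  proof (cases "t = 1")
    \<comment> \<open>Here the walk has wrapped around to the start of its first dart, while
      \<open>\<theta>\<close> has reached an integer.\<close>
    case True
    have "\<theta> 1 = (\<Sum>k<L. \<phi> (p ! k))"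
      unfolding \<theta>_def of_int_sum by (rule sum.cong) (auto simp: max_def min_def)
    then show ?thesis
      using True by (simp add: walk_curve_def h g_def del: of_int_sum)
  next
    case False
    define k where "k = nat \<lfloor>L * t\<rfloor>"
    have "real L * t < real L * 1"
      using False t L by (intro mult_strict_left_mono) auto
    moreover have "0 \<le> real L * t"
      using t by simp
    ultimately have k: "k < L" "real k \<le> L * t" "L * t < k + 1" "frac (L * t) = L * t - k"
      unfolding k_def frac_def by linarith+
    \<comment> \<open>Completed darts contribute integers, which vanish under \<open>cis\<close>;
      only the current dart \<open>k\<close> counts.\<close>
    have "\<theta> t = (\<Sum>j<L. if j < k then \<phi> (p ! j) else if j = k then \<phi> (p ! k) * (L * t - k) else 0)"
      unfolding \<theta>_def
    proof (rule sum.cong)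
      fix j
      consider "j < k" | "j = k" | "j > k" by linarith
      then show "\<phi> (p ! j) * max 0 (min 1 (L * t - j)) =
          (if j < k then \<phi> (p ! j) else if j = k then \<phi> (p ! k) * (L * t - k) else 0)"
      proof cases
        case 1
        then have "real j + 1 \<le> real k" by linarith
        with 1 k show ?thesis by (simp add: max_def min_def)
      next
        case 3
        then have "real k + 1 \<le> real j" by linarith
        with 3 k show ?thesis by (simp add: max_def min_def)
      qed (use k in \<open>simp add: max_def min_def\<close>)
    qed simp
    also have "\<dots> = (\<Sum>j<L. real_of_int (if j < k then \<phi> (p ! j) else 0) +
        (if j = k then \<phi> (p ! k) * (L * t - k) else 0))"
      by (rule sum.cong) auto
    also have "\<dots> = of_int (\<Sum>j<L. (if j < k then \<phi> (p ! j) else 0)) + \<phi> (p ! k) * (L * t - k)"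
      using k by (simp add: sum.distrib)
    finally have "cis (2 * pi * \<theta> t) = cis (2 * pi * (\<phi> (p ! k) * (L * t - k)))"
      by (simp only: cis_add_2pi_int)
    also have "\<dots> = cis (2 * pi * (\<psi> (p ! k) + \<phi> (p ! k) * (L * t - k)))"
      by (simp only: cis_add_2pi_int)
    finally show ?thesis
      using k by (simp add: walk_curve_def h g_def k_def Let_def flip: L_def)
  qed
  from contr obtain c where
    "homotopic_with (\<lambda>h. h 0 = h 1) (top_of_set {0..1}) (surface G arev rot)
      (walk_curve G arev rot p) (\<lambda>_. c)"
    by (auto simp: contractible_loop_def)
  then have "homotopic_loops (- {0}) (h \<circ> walk_curve G arev rot p) (h \<circ> (\<lambda>_. c))"
    unfolding homotopic_loops_def
    by (rule homotopic_with_compose_continuous_map_left[OF _ h(1)])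
      (auto simp: pathstart_def pathfinish_def)
  then have "homotopic_loops (- {0}) (\<lambda>t. cis (2 * pi * \<theta> t)) (\<lambda>_. h c)"
    unfolding homotopic_loops_def
    by (rule homotopic_with_eq) (auto simp: \<theta>_walk pathstart_def pathfinish_def)
  moreover have "continuous_on {0..1} \<theta>"
    unfolding \<theta>_def by (intro continuous_intros)
  ultimately have "\<theta> 1 = \<theta> 0"
    by (rule null_homotopic_cis_lift)
  moreover have "\<theta> 0 = 0"
    unfolding \<theta>_def by (intro sum.neutral) (auto simp: max_def min_def)
  moreover have "\<theta> 1 = (\<Sum>k<L. \<phi> (p ! k))"
    unfolding \<theta>_def of_int_sum by (rule sum.cong) (auto simp: max_def min_def)
  moreover have "(\<Sum>a\<leftarrow>p. \<phi> a) = (\<Sum>k<L. \<phi> (p ! k))"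
    by (simp add: sum_list_sum_nth L_def lessThan_atLeast0)
  ultimately show ?thesis
    by (metis of_int_eq_0_iff)
qed

section \<open>Intersection numbers and face potentials\<close>

text \<open>
  An integer 1-chain from \<open>a\<close> to \<open>b\<close> in the graph whose vertices are the darts: \<open>N d\<close> counts the
  steps from \<open>d\<close> to \<open>rv d\<close> across an edge, and \<open>M d\<close> counts the steps that enter \<open>d\<close> from its
  predecessor under \<open>\<sigma>\<close>, inside one face. For a closed chain, \<open>\<phi> d = N d - N (rv d)\<close> is an integer
  cocycle of the surface, with \<open>\<psi> = - M\<close> as its values on the spokes of the faces.
\<close>

definition face_chain ::
    "'b set \<Rightarrow> ('b \<Rightarrow> 'b) \<Rightarrow> ('b \<Rightarrow> 'b) \<Rightarrow> 'b \<Rightarrow> 'b \<Rightarrow> ('b \<Rightarrow> int) \<Rightarrow> ('b \<Rightarrow> int) \<Rightarrow> bool" where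
  "face_chain A rv \<sigma> a b N M \<longleftrightarrow>
     (\<forall>d\<in>A. of_bool (d = a) + N (rv d) + M d = of_bool (d = b) + N d + M (\<sigma> d))"

lemma face_chainD:
  assumes "face_chain A rv \<sigma> a b N M" "d \<in> A"
  shows "of_bool (d = a) + N (rv d) + M d = of_bool (d = b) + N d + M (\<sigma> d)"
  using assms unfolding face_chain_def by blast

text \<open>Integer coefficients allow chains to be subtracted: this reverses chains, and two chains
  with the same ends differ by a closed one.\<close>

lemma face_chain_diff:
  assumes "face_chain A rv \<sigma> a b N M" "face_chain A rv \<sigma> a c N' M'"
  shows "face_chain A rv \<sigma> b c (\<lambda>d. N' d - N d) (\<lambda>d. M' d - M d)"
  unfolding face_chain_def
proof
  fix d assume d: "d \<in> A"
  show "of_bool (d = b) + (N' (rv d) - N (rv d)) + (M' d - M d) =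
      of_bool (d = c) + (N' d - N d) + (M' (\<sigma> d) - M (\<sigma> d))"
    using face_chainD[OF assms(1) d] face_chainD[OF assms(2) d] by linarith
qed

lemma face_chain_trans:
  assumes "face_chain A rv \<sigma> a b N M" "face_chain A rv \<sigma> b c N' M'"
  shows "face_chain A rv \<sigma> a c (\<lambda>d. N d + N' d) (\<lambda>d. M d + M' d)"
  unfolding face_chain_def
proof
  fix d assume d: "d \<in> A"
  show "of_bool (d = a) + (N (rv d) + N' (rv d)) + (M d + M' d) =
      of_bool (d = c) + (N d + N' d) + (M (\<sigma> d) + M' (\<sigma> d))"
    using face_chainD[OF assms(1) d] face_chainD[OF assms(2) d] by linarith
qed

lemma face_chain_refl: "face_chain A rv \<sigma> a a (\<lambda>_. 0) (\<lambda>_. 0)"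
  by (simp add: face_chain_def)

text \<open>The potential of a dart is the weight of any chain to it from a base dart, where
  crossing from \<open>d\<close> to \<open>rv d\<close> costs \<open>p d - p (rv d)\<close> and
  moving inside a face is free. Independence of the chain is the orthogonality of \<open>p\<close>
  to cocycles, applied to closed chains.\<close>

lemma face_potential_exists:
  fixes p :: "'b \<Rightarrow> int"
  assumes A: "finite A"
    and rv: "\<And>a. a \<in> A \<Longrightarrow> rv a \<in> A" "\<And>a. a \<in> A \<Longrightarrow> rv (rv a) = a"
    and \<sigma>: "inj_on \<sigma> A" "\<And>a. a \<in> A \<Longrightarrow> \<sigma> a \<in> A"
    and orth: "\<And>\<phi> \<psi> :: 'b \<Rightarrow> int. (\<And>a. a \<in> A \<Longrightarrow> \<phi> (rv a) = - \<phi> a) \<Longrightarrow>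
      (\<And>a. a \<in> A \<Longrightarrow> \<psi> (\<sigma> a) = \<psi> a + \<phi> a) \<Longrightarrow> (\<Sum>a\<in>A. p a * \<phi> a) = 0"
  obtains x :: "'b \<Rightarrow> int" where "\<And>a. a \<in> A \<Longrightarrow> x (\<sigma> a) = x a"
    and "\<And>a. a \<in> A \<Longrightarrow> x (rv a) = x a + p a - p (rv a)"
proof -
  define chain where "chain = face_chain A rv \<sigma>"
  define wt where "wt N = (\<Sum>d\<in>A. N d * (p d - p (rv d)))" for N :: "'b \<Rightarrow> int"
  have wt_closed: "wt N = 0" if "chain a a N M" for a N M
  proof -
    \<comment> \<open>The cocycle dual to the closed chain, with \<open>\<psi> = - M\<close>;
      reindexing by \<open>rv\<close> turns its pairing with \<open>p\<close> into
      \<open>wt N\<close>.\<close>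
    have "(\<Sum>d\<in>A. p d * (N d - N (rv d))) = 0"
    proof (rule orth)
      fix d assume "d \<in> A"
      from face_chainD[OF that[unfolded chain_def] this]
      show "- M (\<sigma> d) = - M d + (N d - N (rv d))"
        by linarith
    qed (simp add: rv)
    moreover have "(\<Sum>d\<in>A. N d * p (rv d)) = (\<Sum>d\<in>A. N (rv d) * p d)"
      by (rule sum.reindex_bij_witness[of _ rv rv]) (auto simp: rv)
    ultimately show ?thesis
      by (simp add: wt_def right_diff_distrib sum_subtractf mult.commute)
  qed
  have wt_diff: "wt (\<lambda>d. N' d - N d) = wt N' - wt N" for N N'
    by (simp add: wt_def left_diff_distrib sum_subtractf)
  have wt_unique: "wt N = wt N'" if "chain a b N M" "chain a b N' M'" for a b N M N' M'
    using wt_closed[OF face_chain_diff[OF that[unfolded chain_def], folded chain_def]]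
    by (simp add: wt_diff)
  define linked where "linked a b \<longleftrightarrow> (\<exists>N M. chain a b N M)" for a b
  have linked_refl: "linked a a" for a
    unfolding linked_def chain_def by (intro exI) (rule face_chain_refl)
  have linked_sym: "linked b a" if "linked a b" for a b
  proof -
    from that obtain N M where "face_chain A rv \<sigma> a b N M"
      by (auto simp: linked_def chain_def)
    from face_chain_diff[OF this face_chain_refl] show ?thesis
      unfolding linked_def chain_def by (intro exI)
  qed
  have linked_trans: "linked a c" if "linked a b" "linked b c" for a b c
  proof -
    from that obtain N M N' M' where
      "face_chain A rv \<sigma> a b N M" "face_chain A rv \<sigma> b c N' M'"
      by (auto simp: linked_def chain_def)
    from face_chain_trans[OF this] show ?thesis
      unfolding linked_def chain_def by (intro exI)
  qed
  \<comment> \<open>Linked darts satisfy the same predicate under \<open>SOME\<close>, so they get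
    the same base.\<close>
  define base where "base b = (SOME a. linked a b)" for b
  have linked_base: "linked (base b) b" for b
    unfolding base_def using linked_refl by (rule someI)
  have base_cong: "base a = base b" if "linked a b" for a b
    unfolding base_def using that linked_sym linked_trans by metis
  define x where "x b = (SOME w. \<exists>N M. chain (base b) b N M \<and> w = wt N)" for b
  have x: "x b = wt N" if "chain (base b) b N M" for b N M
    unfolding x_def
  proof (rule some_equality)
    show "\<exists>N' M'. chain (base b) b N' M' \<and> wt N = wt N'"
      using that by blast
    fix w assume "\<exists>N' M'. chain (base b) b N' M' \<and> w = wt N'"
    then obtain N' M' where N': "chain (base b) b N' M'" "w = wt N'"
      by (elim exE conjE)
    show "w = wt N"
      unfolding N'(2) by (rule wt_unique[OF N'(1) that])
  qed
  have step: "x b = x a + wt N" if "chain a b N M" for a b N M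
  proof -
    obtain N' M' where *: "chain (base a) a N' M'"
      using linked_base unfolding linked_def by blast
    from that have "base b = base a"
      using base_cong unfolding linked_def by metis
    then have "chain (base b) b (\<lambda>d. N' d + N d) (\<lambda>d. M' d + M d)"
      using face_chain_trans[OF *[unfolded chain_def] that[unfolded chain_def]]
      by (simp add: chain_def)
    from x[OF this] x[OF *] show ?thesis
      by (simp add: wt_def distrib_right sum.distrib)
  qed
  show thesis
  proof
    fix a assume a: "a \<in> A"
    \<comment> \<open>The chain of a single step inside a face; injectivity of
      \<open>\<sigma>\<close> makes \<open>a\<close> the only dart that this step leaves.\<close>
    have "chain a (\<sigma> a) (\<lambda>_. 0) (\<lambda>d. of_bool (d = \<sigma> a))"
      using a \<sigma> by (auto simp: chain_def face_chain_def inj_on_eq_iff)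
    from step[OF this] show "x (\<sigma> a) = x a"
      by (simp add: wt_def)
    have "rv d = a \<longleftrightarrow> d = rv a" if "d \<in> A" for d
      using that a rv by metis
    then have "chain a (rv a) (\<lambda>d. of_bool (d = a)) (\<lambda>_. 0)"
      by (auto simp: chain_def face_chain_def)
    from step[OF this] a show "x (rv a) = x a + p a - p (rv a)"
      by (simp add: wt_def A of_bool_def if_distrib[where f = "\<lambda>c. c * _"] cong: if_cong)
  qed
qed

text \<open>The indicator of a traversal is orthogonal to all cocycles, since their sums along the
  contractible walk vanish. Its potential jumps by 1 or -1 across the edges of \<open>H\<close>,
  because exactly one dart of each is traversed, and by 0 across all others.\<close>

lemma contractible_cycle_bounds:
  assumes graph: "embedded_graph G arev rot"
    and H: "wf_digraph H" "arcs H \<subseteq> arcs G"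
    and contr: "contractible_cycle G arev rot H"
  obtains x :: "'b \<Rightarrow> int" where "\<And>a. a \<in> arcs G \<Longrightarrow> x (rot (arev a)) = x a"
    and "\<And>a. a \<in> arcs G \<Longrightarrow> odd (x (arev a) - x a) \<longleftrightarrow> a \<in> arcs H"
proof -
  interpret embedded_graph G arev rot by fact
  interpret H: wf_digraph H by fact
  obtain p where p: "traverses arev H p"
    and contr: "contractible_loop (surface G arev rot) (walk_curve G arev rot p)"
    using contr by (auto simp: contractible_cycle_def)
  have arcs_H: "arcs H = set p \<union> arev ` set p" and disj: "set p \<inter> arev ` set p = {}"
    using p by (auto simp: traverses_def)
  have "p \<noteq> []" "distinct p"
    using p H.distinct_tl_verts_imp_distinct by (auto simp: traverses_def H.cycle_def)
  have p_G: "set p \<subseteq> arcs G"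
    using arcs_H H by auto
  have rot_in: "rot a \<in> out_arcs G (tail G a)" if "a \<in> arcs G" for a
    using that by (intro cyclic_on_inI[OF rot_cyclic]) auto
  \<comment> \<open>Each dart lies in its own orbit and so has a predecessor; a surjection of a
    finite set onto itself is injective.\<close>
  have rot_inj: "inj_on rot (out_arcs G v)" if "v \<in> verts G" "out_arcs G v \<noteq> {}" for v
  proof (rule finite_surj_inj)
    have orbit: "out_arcs G v = orbit rot s" if "s \<in> out_arcs G v" for s
      using rot_cyclic[OF \<open>v \<in> verts G\<close> \<open>out_arcs G v \<noteq> {}\<close>] that by (auto simp only: cyclic_on_alldef)
    show "out_arcs G v \<subseteq> rot ` out_arcs G v"
    proof
      fix s assume s: "s \<in> out_arcs G v"
      then have "s \<in> orbit rot s"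
        using orbit by blast
      then show "s \<in> rot ` out_arcs G v"
        by cases (use s orbit[OF s] in blast)+
    qed
  qed (rule finite_out_arcs)
  have face_inj: "inj_on (\<lambda>a. rot (arev a)) (arcs G)"
  proof (rule inj_onI)
    fix a b assume a: "a \<in> arcs G" and b: "b \<in> arcs G" and eq: "rot (arev a) = rot (arev b)"
    then have "tail G (arev a) = tail G (arev b)"
      using rot_in[of "arev a"] rot_in[of "arev b"] by auto
    then have "arev a \<in> out_arcs G (tail G (arev a))" "arev b \<in> out_arcs G (tail G (arev a))"
      using a b by auto
    then have "arev a = arev b"
      using a by (intro inj_onD[OF rot_inj eq]) auto
    then show "a = b"
      by (simp add: arev_eq_iff)
  qed
  have orth: "(\<Sum>a\<in>arcs G. of_bool (a \<in> set p) * \<phi> a) = 0"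
    if "\<And>a. a \<in> arcs G \<Longrightarrow> \<phi> (arev a) = - \<phi> a"
      "\<And>a. a \<in> arcs G \<Longrightarrow> \<psi> (rot (arev a)) = \<psi> a + \<phi> a" for \<phi> \<psi> :: "'b \<Rightarrow> int"
  proof -
    have "(\<Sum>a\<in>arcs G. of_bool (a \<in> set p) * \<phi> a) = (\<Sum>a\<in>set p. \<phi> a)"
      by (rule sum.mono_neutral_cong_right) (use p_G in auto)
    also have "\<dots> = (\<Sum>a\<leftarrow>p. \<phi> a)"
      using \<open>distinct p\<close> by (simp add: sum_list_distinct_conv_sum_set)
    also have "\<dots> = 0"
      by (rule contractible_walk_sum_eq_0[OF that \<open>p \<noteq> []\<close> contr])
    finally show ?thesis .
  qed
  show thesis
  proof (rule face_potential_exists[OF finite_arcs arev_in_arcs arev_arev face_inj _ orth])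
    show "rot (arev a) \<in> arcs G" if "a \<in> arcs G" for a
      using rot_in[of "arev a"] that by simp
  next
    fix x :: "'b \<Rightarrow> int"
    assume x: "\<And>a. a \<in> arcs G \<Longrightarrow> x (rot (arev a)) = x a"
      "\<And>a. a \<in> arcs G \<Longrightarrow> x (arev a) = x a + of_bool (a \<in> set p) - of_bool (arev a \<in> set p)"
    have "odd (x (arev a) - x a) \<longleftrightarrow> a \<in> arcs H" if "a \<in> arcs G" for a
    proof -
      have "a \<in> arev ` set p \<longleftrightarrow> arev a \<in> set p"
        by (metis arev_arev imageE image_eqI)
      then show ?thesis
        using x(2)[OF that] disj by (auto simp: arcs_H)
    qed
    with x(1) show thesis
      using that by blast
  qed
qed

section \<open>Colouring the faces by the reflection cycles\<close>

text \<open>Produces a component in the form that \<open>reflection_cycle\<close> demands. Any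
  larger connected subgraph contains \<open>u\<close>, and symmetry of \<open>R\<close> turns its
  undirected connections into directed reachability from \<open>u\<close>.\<close>

lemma max_connected_subgraph_reachable:
  assumes "wf_digraph R" "symmetric R" "u \<in> verts R"
  shows "pre_digraph.max_subgraph R Digraph_Component.connected (R \<restriction> {v. u \<rightarrow>\<^sup>*\<^bsub>R\<^esub> v})"
proof -
  interpret wf_digraph R by fact
  interpret sym_digraph R by unfold_locales fact
  define C where "C = R \<restriction> {v. u \<rightarrow>\<^sup>*\<^bsub>R\<^esub> v}"
  have C: "verts C = {v. u \<rightarrow>\<^sup>*\<^bsub>R\<^esub> v}"
    "arcs C = {e \<in> arcs R. u \<rightarrow>\<^sup>*\<^bsub>R\<^esub> tail R e \<and> u \<rightarrow>\<^sup>*\<^bsub>R\<^esub> head R e}"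
    "tail C = tail R" "head C = head R"
    by (auto simp: C_def)
  have "C \<in> sccs"
    unfolding C_def using assms(3) by (rule induce_reachable_is_in_sccs)
  then have sub: "subgraph C R" and "strongly_connected C"
    by (auto simp: sccs_def induced_subgraph_def)
  then interpret C: wf_digraph C
    by auto
  have "Digraph_Component.connected C"
    using \<open>strongly_connected C\<close> C.reachable_mk_symmetricI
    by (auto simp: strongly_connected_def intro!: C.connectedI)
  moreover have "H = C" if "subgraph C H" "subgraph H R" "Digraph_Component.connected H" for H
  proof -
    interpret H: wf_digraph H
      using that by auto
    have "u \<in> verts H"
      using that(1) assms(3) C(1) by (auto simp: subgraph_def)
    have "u \<rightarrow>\<^sup>*\<^bsub>R\<^esub> v" if "v \<in> verts H" for v
    proof -
      have "u \<rightarrow>\<^sup>*\<^bsub>with_proj (mk_symmetric H)\<^esub> v"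
        using \<open>Digraph_Component.connected H\<close> \<open>u \<in> verts H\<close> that
        by (auto simp: Digraph_Component.connected_def strongly_connected_def)
      then have "u \<rightarrow>\<^sup>*\<^bsub>with_proj (mk_symmetric R)\<^esub> v"
        using subgraph_mk_symmetric[OF \<open>subgraph H R\<close>] by (rule pre_digraph.reachable_mono)
      then show ?thesis
        using reachable_mk_symmetric_eq[OF assms(2)] by simp
    qed
    then show ?thesis
      using that(1,2) C H.wellformed
      by (intro pre_digraph.equality) (auto simp: subgraph_def compatible_def)
  qed
  ultimately show ?thesis
    using sub unfolding pre_digraph.max_subgraph_def C_def by blast
qed

lemma reflection_subgraph_simps [simp]:
  "arcs (reflection_subgraph n G arev f) = {a \<in> arcs G. f (dart_edge arev a) \<in> reflections n}"
  "verts (reflection_subgraph n G arev f) = tail G ` arcs (reflection_subgraph n G arev f)"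
  "tail (reflection_subgraph n G arev f) = tail G"
  "head (reflection_subgraph n G arev f) = head G"
  by (simp_all add: reflection_subgraph_def Let_def)

lemma reflection_cycle_reachable:
  assumes "embedded_graph G arev rot" "a \<in> arcs (reflection_subgraph n G arev f)"
  defines "R \<equiv> reflection_subgraph n G arev f"
  shows "reflection_cycle n G arev f (R \<restriction> {v. tail G a \<rightarrow>\<^sup>*\<^bsub>R\<^esub> v})"
    and "wf_digraph R" "symmetric R"
proof -
  interpret embedded_graph G arev rot by fact
  have R: "verts R = tail G ` arcs R" "arcs R \<subseteq> arcs G" "tail R = tail G" "head R = head G"
    by (auto simp: R_def)
  have arev_R: "arev b \<in> arcs R" if "b \<in> arcs R" for b
    using that by (auto simp: R_def dart_edge_def insert_commute)
  show wf: "wf_digraph R"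
  proof
    fix b assume b: "b \<in> arcs R"
    then show "tail R b \<in> verts R"
      using R by auto
    show "head R b \<in> verts R"
      using R arev_R[OF b] b by (auto intro!: rev_image_eqI[of "arev b"])
  qed
  show sym: "symmetric R"
    unfolding symmetric_conv
    using R arev_R by (metis head_arev subset_eq tail_arev)
  show "reflection_cycle n G arev f (R \<restriction> {v. tail G a \<rightarrow>\<^sup>*\<^bsub>R\<^esub> v})"
    unfolding reflection_cycle_def R_def[symmetric]
    by (rule max_connected_subgraph_reachable[OF wf sym]) (use assms(2) R in \<open>auto simp: R_def\<close>)
qed

text \<open>The potentials of all reflection cycles are added up. Every reflection dart lies on
  exactly one cycle, so the parity of the sum is the desired 2-colouring of the faces.\<close>

lemma reflection_colouring:
  assumes graph: "embedded_graph G arev rot"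
    and contr: "\<And>H. reflection_cycle n G arev f H \<Longrightarrow> contractible_cycle G arev rot H"
  defines "R \<equiv> reflection_subgraph n G arev f"
  obtains x :: "'b \<Rightarrow> int" where "\<And>a. a \<in> arcs G \<Longrightarrow> x (rot (arev a)) = x a"
    and "\<And>a. a \<in> arcs G \<Longrightarrow> odd (x (arev a) - x a) \<longleftrightarrow> a \<in> arcs R"
proof -
  interpret embedded_graph G arev rot by fact
  have R: "arcs R \<subseteq> arcs G" "tail R = tail G" "head R = head G" "verts R = tail G ` arcs R"
    by (auto simp: R_def)
  note refl = reflection_cycle_reachable[OF graph, of _ n f, folded R_def]
  define comp where "comp a = R \<restriction> {v. tail G a \<rightarrow>\<^sup>*\<^bsub>R\<^esub> v}" for a
  \<comment> \<open>Being a set, this counts a component once although it arises from each of its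
    darts.\<close>
  define \<H> where "\<H> = comp ` arcs R"
  have "finite \<H>"
    unfolding \<H>_def by (intro finite_imageI finite_subset[OF R(1)] finite_arcs)
  have comp_self: "a \<in> arcs (comp a)" if a: "a \<in> arcs R" for a
  proof -
    interpret R: wf_digraph R
      using refl(2)[OF a] .
    have "tail R a \<rightarrow>\<^sup>*\<^bsub>R\<^esub> head R a" "tail R a \<rightarrow>\<^sup>*\<^bsub>R\<^esub> tail R a"
      using a by (auto intro: R.in_arcs_imp_in_arcs_ends)
    then show ?thesis
      using a R by (simp add: comp_def)
  qed
  have comp_unique: "comp b = comp a" if a: "a \<in> arcs (comp b)" and b: "b \<in> arcs R" for a b
  proof -
    interpret R: wf_digraph R
      using refl(2)[OF b] .
    have "tail G b \<rightarrow>\<^sup>*\<^bsub>R\<^esub> tail G a"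
      using a R by (simp add: comp_def)
    moreover from this have "tail G a \<rightarrow>\<^sup>*\<^bsub>R\<^esub> tail G b"
      using refl(3)[OF b] symmetric_reachable by metis
    ultimately have "{v. tail G b \<rightarrow>\<^sup>*\<^bsub>R\<^esub> v} = {v. tail G a \<rightarrow>\<^sup>*\<^bsub>R\<^esub> v}"
      by (auto intro: R.reachable_trans)
    then show ?thesis
      by (simp add: comp_def)
  qed
  have "\<exists>x :: 'b \<Rightarrow> int. \<forall>a\<in>arcs G. x (rot (arev a)) = x a \<and>
      (odd (x (arev a) - x a) \<longleftrightarrow> a \<in> arcs H)" if H: "H \<in> \<H>" for H
  proof -
    obtain b where b: "b \<in> arcs R" "H = comp b"
      using H unfolding \<H>_def by blast
    interpret R: wf_digraph R
      using refl(2)[OF b(1)] .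
    have "wf_digraph H" "arcs H \<subseteq> arcs G"
      using R(1) by (auto simp: b comp_def)
    moreover have "contractible_cycle G arev rot H"
      using contr refl(1)[OF b(1)] by (simp add: b comp_def)
    ultimately show ?thesis
      using contractible_cycle_bounds[OF graph] by metis
  qed
  then obtain x :: "('a, 'b) pre_digraph \<Rightarrow> 'b \<Rightarrow> int" where x:
    "\<And>H a. H \<in> \<H> \<Longrightarrow> a \<in> arcs G \<Longrightarrow> x H (rot (arev a)) = x H a"
    "\<And>H a. H \<in> \<H> \<Longrightarrow> a \<in> arcs G \<Longrightarrow> odd (x H (arev a) - x H a) \<longleftrightarrow> a \<in> arcs H"
    by metis
  show thesis
  proof
    fix a assume a: "a \<in> arcs G"
    show "(\<Sum>H\<in>\<H>. x H (rot (arev a))) = (\<Sum>H\<in>\<H>. x H a)"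
      by (rule sum.cong) (use x a in auto)
    have "{H \<in> \<H>. odd (x H (arev a) - x H a)} = {H \<in> \<H>. a \<in> arcs H}"
      using x(2) a by blast
    also have "\<dots> = (if a \<in> arcs R then {comp a} else {})"
      using comp_self comp_unique by (auto simp: \<H>_def comp_def)
    finally show "odd ((\<Sum>H\<in>\<H>. x H (arev a)) - (\<Sum>H\<in>\<H>. x H a)) \<longleftrightarrow> a \<in> arcs R"
      using \<open>finite \<H>\<close> by (simp add: even_sum_iff flip: sum_subtractf)
  qed
qed

section \<open>Tutte's theorem\<close>

text \<open>Telescoping: a step \<open>e\<close> adds 1 at its tail and, through
  \<open>arev e\<close>, subtracts 1 at its head. Distinctness makes the indicator of
  \<open>set p\<close> additive in the steps.\<close>

lemma walk_divergence:
  assumes "bidirected_digraph G arev" "fin_digraph G"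
    and "pre_digraph.cas G u p w" "set p \<subseteq> arcs G" "distinct p"
  shows "(\<Sum>a\<in>out_arcs G x. of_bool (a \<in> set p) - of_bool (arev a \<in> set p)) =
    (of_bool (x = u) - of_bool (x = w) :: int)"
proof -
  interpret bidirected_digraph G arev by fact
  interpret fin_digraph G by fact
  show ?thesis
    using assms(3-5)
  proof (induction p arbitrary: u)
    case Nil
    then show ?case by simp
  next
    case (Cons e p)
    then have e: "e \<in> arcs G" "e \<notin> set p" "tail G e = u" and p: "cas (head G e) p w"
      by auto
    have "(of_bool (a \<in> set (e # p)) - of_bool (arev a \<in> set (e # p)) :: int) =
        (of_bool (a \<in> set p) - of_bool (arev a \<in> set p)) +
        ((if a = e then 1 else 0) - (if a = arev e then 1 else 0))" for a
      using e by (auto simp: of_bool_def)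
    then have "(\<Sum>a\<in>out_arcs G x. of_bool (a \<in> set (e # p)) - of_bool (arev a \<in> set (e # p))) =
        (\<Sum>a\<in>out_arcs G x. of_bool (a \<in> set p) - of_bool (arev a \<in> set p)) +
        ((\<Sum>a\<in>out_arcs G x. if a = e then 1 else 0) -
         (\<Sum>a\<in>out_arcs G x. if a = arev e then 1 else (0 :: int)))"
      by (simp only: flip: sum.distrib sum_subtractf)
    also have "(\<Sum>a\<in>out_arcs G x. of_bool (a \<in> set p) - of_bool (arev a \<in> set p)) =
        (of_bool (x = head G e) - of_bool (x = w) :: int)"
      using Cons p by simp
    also have "(\<Sum>a\<in>out_arcs G x. if a = e then 1 else 0) = (of_bool (x = u) :: int)"
      using e by (auto simp: finite_out_arcs)
    also have "(\<Sum>a\<in>out_arcs G x. if a = arev e then 1 else 0) = (of_bool (x = head G e) :: int)"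
      using e by (auto simp: finite_out_arcs)
    finally show ?case
      by simp
  qed
qed

text \<open>
  Among the integer lifts with values of absolute value below \<open>n\<close>, a lift of least total excess
  is conservative: otherwise a path of positive darts joins a vertex of positive excess to one of
  negative excess, and subtracting \<open>n\<close> along it lowers the total.
\<close>

lemma modular_flow_imp_integer_flow:
  fixes z :: "'b \<Rightarrow> int" and n :: int
  assumes graph: "bidirected_digraph G arev" "fin_digraph G" and "n > 0"
    and ori: "orientation G arev ori"
    and antisym: "\<And>a. a \<in> arcs G \<Longrightarrow> n dvd z (arev a) + z a"
    and cons: "\<And>v. v \<in> verts G \<Longrightarrow> n dvd (\<Sum>a\<in>out_arcs G v. z a)"
  obtains y where "\<And>a. a \<in> arcs G \<Longrightarrow> y (arev a) = - y a"
    and "\<And>a. a \<in> arcs G \<Longrightarrow> \<bar>y a\<bar> < n" "\<And>a. a \<in> arcs G \<Longrightarrow> n dvd y a - z a"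
    and "\<And>v. v \<in> verts G \<Longrightarrow> (\<Sum>a\<in>out_arcs G v. y a) = 0"
proof -
  interpret bidirected_digraph G arev by fact
  interpret fin_digraph G by fact
  define lift where "lift y \<longleftrightarrow>
    (\<forall>a\<in>arcs G. y (arev a) = - y a \<and> \<bar>y a\<bar> < n \<and> n dvd y a - z a)" for y
  define ex where "ex y v = (\<Sum>a\<in>out_arcs G v. y a)" for y :: "'b \<Rightarrow> int" and v
  define total where "total y = (\<Sum>v\<in>verts G. \<bar>ex y v\<bar>)" for y
  \<comment> \<open>Residues are taken on \<open>ori\<close> only and negated on the opposite darts,
    since \<open>z\<close> is antisymmetric merely modulo \<open>n\<close>.\<close>
  have "lift (\<lambda>a. if a \<in> ori then z a mod n else - (z (arev a) mod n))"
    unfolding lift_def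
  proof (intro ballI conjI)
    fix a assume a: "a \<in> arcs G"
    with ori have *: "(a \<in> ori) \<noteq> (arev a \<in> ori)"
      unfolding orientation_def by blast
    then show "(if arev a \<in> ori then z (arev a) mod n else - (z (arev (arev a)) mod n)) =
        - (if a \<in> ori then z a mod n else - (z (arev a) mod n))"
      by auto
    show "\<bar>if a \<in> ori then z a mod n else - (z (arev a) mod n)\<bar> < n"
      using \<open>n > 0\<close> by (simp add: abs_of_nonneg)
    have "- (z (arev a) mod n) - z a = - (z (arev a) + z a) + n * (z (arev a) div n)"
      by (simp add: minus_div_mult_eq_mod [symmetric] algebra_simps)
    then have "n dvd - (z (arev a) mod n) - z a"
      using antisym[OF a] by (metis dvd_add dvd_minus_iff dvd_triv_left)
    moreover have "n dvd z a mod n - z a"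
      by (simp add: mod_eq_dvd_iff [symmetric])
    ultimately show "n dvd (if a \<in> ori then z a mod n else - (z (arev a) mod n)) - z a"
      by simp
  qed
  then obtain y where y: "lift y" and least: "\<And>y'. lift y' \<Longrightarrow> nat (total y) \<le> nat (total y')"
    using ex_has_least_nat[of lift _ "\<lambda>y. nat (total y)"] by blast
  have y_rev: "y (arev a) = - y a" and y_bound: "\<bar>y a\<bar> < n" and y_dvd: "n dvd y a - z a"
    if "a \<in> arcs G" for a
    using y that by (auto simp: lift_def)
  have ex_dvd: "n dvd ex y v" if "v \<in> verts G" for v
  proof -
    have "n dvd (\<Sum>a\<in>out_arcs G v. y a - z a)"
      by (rule dvd_sum) (simp add: y_dvd)
    with cons[OF that] show ?thesis
      by (metis ex_def sum_subtractf dvd_add diff_add_cancel)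
  qed
  \<comment> \<open>Darts with both ends in \<open>X\<close> cancel against their reverses, leaving
    the darts that exit \<open>X\<close>.\<close>
  have ex_sum: "(\<Sum>v\<in>X. ex y v) = (\<Sum>a | a \<in> arcs G \<and> tail G a \<in> X \<and> head G a \<notin> X. y a)"
    if "X \<subseteq> verts G" for X
  proof -
    let ?I = "{a \<in> arcs G. tail G a \<in> X \<and> head G a \<in> X}"
    let ?O = "{a \<in> arcs G. tail G a \<in> X \<and> head G a \<notin> X}"
    have "(\<Sum>a\<in>?I. y a) = (\<Sum>a\<in>?I. - y a)"
      by (rule sum.reindex_bij_witness[of _ arev arev]) (auto simp: y_rev)
    then have 0: "(\<Sum>a\<in>?I. y a) = 0"
      by (simp add: sum_negf)
    have "(\<Sum>v\<in>X. ex y v) = (\<Sum>a\<in>(\<Union>v\<in>X. out_arcs G v). y a)"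
      unfolding ex_def using that finite_subset[OF that finite_verts]
      by (intro sum.UNION_disjoint [symmetric]) auto
    also have "(\<Union>v\<in>X. out_arcs G v) = ?I \<union> ?O"
      by auto
    also have "(\<Sum>a\<in>?I \<union> ?O. y a) = (\<Sum>a\<in>?I. y a) + (\<Sum>a\<in>?O. y a)"
      by (rule sum.union_disjoint) auto
    finally show ?thesis
      using 0 by simp
  qed
  \<comment> \<open>One inequality suffices, as the excesses of all vertices add up to zero.\<close>
  have "ex y v \<le> 0" if v: "v \<in> verts G" for v
  proof (rule ccontr)
    assume "\<not> ex y v \<le> 0"
    with ex_dvd[OF v] have ex_v: "ex y v \<ge> n"
      by (simp add: zdvd_imp_le)
    define P where "P = G\<lparr>arcs := {a \<in> arcs G. y a > 0}\<rparr>"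
    have P [simp]: "verts P = verts G" "arcs P = {a \<in> arcs G. y a > 0}" "tail P = tail G"
      "head P = head G"
      by (simp_all add: P_def)
    interpret P: wf_digraph P
      by unfold_locales auto
    define X where "X = {w. v \<rightarrow>\<^sup>*\<^bsub>P\<^esub> w}"
    have X: "X \<subseteq> verts G" "v \<in> X"
      using v P.reachable_in_verts by (auto simp: X_def)
    show False
    proof (cases "\<exists>w\<in>X. ex y w < 0")
      case True
      then obtain w where w: "v \<rightarrow>\<^sup>*\<^bsub>P\<^esub> w" "ex y w < 0"
        by (auto simp: X_def)
      then have "w \<in> verts G"
        using X by (auto simp: X_def)
      with w ex_dvd[of w] have ex_w: "- ex y w \<ge> n"
        by (intro zdvd_imp_le) auto
      obtain p where p: "P.apath v p w"
        using w P.reachable_awalk P.apath_awalk_to_apath by metis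
      then have p_walk: "P.awalk v p w" and dist: "distinct p"
        by (auto simp: P.apath_def dest: P.distinct_verts_imp_distinct)
      then have p_arcs: "set p \<subseteq> {a \<in> arcs G. y a > 0}" and "P.cas v p w"
        by (auto simp: P.awalk_def)
      moreover have "pre_digraph.cas G = P.cas"
        by (rule compatible_cas) (simp add: compatible_def)
      ultimately have div: "(\<Sum>a\<in>out_arcs G x. of_bool (a \<in> set p) - of_bool (arev a \<in> set p)) =
          (of_bool (x = v) - of_bool (x = w) :: int)" for x
        using dist by (intro walk_divergence[OF graph]) auto
      \<comment> \<open>Path darts have values strictly between 0 and \<open>n\<close>, so
        subtracting \<open>n\<close> keeps the bound. The excesses at \<open>v\<close> and
        \<open>w\<close> are at least \<open>n\<close> in absolute value, so both move towards zero
        without overshooting.\<close>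
      define y' where "y' a = y a - n * (of_bool (a \<in> set p) - of_bool (arev a \<in> set p))" for a
      have "lift y'"
        unfolding lift_def
      proof (intro ballI conjI)
        fix a assume a: "a \<in> arcs G"
        show "y' (arev a) = - y' a"
          using y_rev[OF a] by (simp add: y'_def algebra_simps)
        show "\<bar>y' a\<bar> < n"
          using y_rev[OF a] y_bound[OF a] p_arcs by (auto simp: y'_def of_bool_def)
        have "y' a - z a = (y a - z a) - n * (of_bool (a \<in> set p) - of_bool (arev a \<in> set p))"
          by (simp add: y'_def)
        then show "n dvd y' a - z a"
          using y_dvd[OF a] by (metis dvd_diff dvd_triv_left)
      qed
      have ex': "ex y' x = ex y x - n * (of_bool (x = v) - of_bool (x = w))" for x
        unfolding ex_def y'_def sum_subtractf by (simp only: div flip: sum_distrib_left sum_subtractf)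
      have "total y' < total y"
        unfolding total_def
      proof (rule sum_strict_mono_ex1)
        show "\<forall>x\<in>verts G. \<bar>ex y' x\<bar> \<le> \<bar>ex y x\<bar>"
          using ex_v ex_w \<open>n > 0\<close> by (auto simp: ex')
        show "\<exists>x\<in>verts G. \<bar>ex y' x\<bar> < \<bar>ex y x\<bar>"
          using ex_v ex_w \<open>n > 0\<close> v by (intro bexI[of _ v]) (auto simp: ex')
      qed simp
      moreover have "total y' \<ge> 0"
        by (simp add: total_def sum_nonneg)
      ultimately show False
        using least[OF \<open>lift y'\<close>] by linarith
    next
      case False
      \<comment> \<open>Otherwise \<open>X\<close> has positive total excess, although no positive
        dart leaves it.\<close>
      have "0 < (\<Sum>w\<in>X. ex y w)"
        using X False ex_v \<open>n > 0\<close> finite_subset[OF X(1)] by (intro sum_pos2[of _ v]) (auto simp: not_less)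
      also have "\<dots> = (\<Sum>a | a \<in> arcs G \<and> tail G a \<in> X \<and> head G a \<notin> X. y a)"
        by (rule ex_sum[OF X(1)])
      also have "\<dots> \<le> 0"
      proof (rule sum_nonpos)
        fix a assume a: "a \<in> {a \<in> arcs G. tail G a \<in> X \<and> head G a \<notin> X}"
        show "y a \<le> 0"
        proof (rule ccontr)
          assume "\<not> y a \<le> 0"
          with a have "tail G a \<rightarrow>\<^bsub>P\<^esub> head G a"
            by (auto simp: arcs_ends_def arc_to_ends_def intro!: rev_image_eqI[of a])
          with a show False
            by (auto simp: X_def dest: P.reachable_adj_trans)
        qed
      qed
      finally show False by simp
    qed
  qed
  moreover have "(\<Sum>v\<in>verts G. ex y v) = 0"
    by (subst ex_sum) (auto intro: sum.neutral)
  ultimately have "ex y v = 0" if "v \<in> verts G" for v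
    using that sum_nonneg_eq_0_iff[of "verts G" "\<lambda>v. - ex y v"] by (auto simp: sum_negf)
  then show thesis
    using that[of y] y_rev y_bound y_dvd by (simp add: ex_def)
qed

lemma integer_flow_imp_nowhere_zero_flow:
  assumes graph: "bidirected_digraph G arev" "fin_digraph G" and ori: "orientation G arev ori"
    and rev: "\<And>a. a \<in> arcs G \<Longrightarrow> y (arev a) = - y a"
    and bound: "\<And>a. a \<in> arcs G \<Longrightarrow> \<bar>y a\<bar> < int n"
    and nonzero: "\<And>a. a \<in> arcs G \<Longrightarrow> y a \<noteq> 0"
    and cons: "\<And>v. v \<in> verts G \<Longrightarrow> (\<Sum>a\<in>out_arcs G v. y a) = 0"
  shows "has_nowhere_zero_flow G arev n"
proof -
  interpret bidirected_digraph G arev by fact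
  interpret fin_digraph G by fact
  have ori_G: "ori \<subseteq> arcs G"
    using ori by (simp add: orientation_def)
  have ori_iff: "a \<in> ori \<longleftrightarrow> arev a \<notin> ori" if "a \<in> arcs G" for a
    using ori that unfolding orientation_def by blast
  \<comment> \<open>The intersection is a singleton for every edge, so \<open>g\<close> reads off
    the value of the oriented dart.\<close>
  define g where "g e = (\<Sum>a\<in>e \<inter> ori. y a)" for e
  have g: "g (dart_edge arev a) = y a" if "a \<in> ori" for a
  proof -
    have "dart_edge arev a \<inter> ori = {a}"
      using that ori_G ori_iff[of a] by (auto simp: dart_edge_def)
    then show ?thesis
      by (simp add: g_def)
  qed
  have "kirchhoff G arev ori g"
    unfolding kirchhoff_def
  proof
    fix v assume "v \<in> verts G"
    have "(\<Sum>a\<in>in_arcs G v \<inter> ori. g (dart_edge arev a)) = (\<Sum>a\<in>in_arcs G v \<inter> ori. y a)"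
      by (rule sum.cong) (auto simp: g)
    also have "\<dots> = (\<Sum>a\<in>out_arcs G v - ori. - y a)"
      by (rule sum.reindex_bij_witness[of _ arev arev]) (use ori_iff rev in auto)
    also have "\<dots> = (\<Sum>a\<in>out_arcs G v \<inter> ori. y a)"
      using cons[OF \<open>v \<in> verts G\<close>] sum.Int_Diff[OF finite_out_arcs, of y v ori]
      by (simp add: sum_negf)
    also have "\<dots> = (\<Sum>a\<in>out_arcs G v \<inter> ori. g (dart_edge arev a))"
      by (rule sum.cong) (auto simp: g)
    finally show "(\<Sum>a\<in>in_arcs G v \<inter> ori. g (dart_edge arev a)) =
        (\<Sum>a\<in>out_arcs G v \<inter> ori. g (dart_edge arev a))" .
  qed
  moreover have "1 \<le> \<bar>g e\<bar> \<and> \<bar>g e\<bar> \<le> int n - 1" if "e \<in> edges G arev" for e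
  proof -
    from that obtain b where b: "b \<in> arcs G" "e = dart_edge arev b"
      by (auto simp: edges_def)
    have "dart_edge arev (arev b) = e"
      using b by (auto simp: dart_edge_def)
    then obtain a where a: "a \<in> ori" "e = dart_edge arev a"
      using b ori_iff by metis
    then have "a \<in> arcs G"
      using ori_G by blast
    with a g bound[of a] nonzero[of a] show ?thesis
      by auto
  qed
  ultimately show ?thesis
    using ori by (auto simp: has_nowhere_zero_flow_def)
qed

section \<open>Dihedral flows\<close>

lemma dihedral_inv:
  assumes "n > 0" "(d, b) \<in> carrier (dihedral n)"
  shows "inv\<^bsub>dihedral n\<^esub> (d, b) = (d, (- d * b) mod int n)"
proof -
  interpret group "dihedral n"
    using assms(1) by (rule group_dihedral)
  show ?thesis
    by (rule inv_equality) (use assms in \<open>auto simp: dihedral_def mod_simps\<close>)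
qed

text \<open>Powers of \<open>dihedral_r\<close> exhaust the elements of sign 1, and these form a
  subgroup.\<close>

lemma mem_reflections_iff:
  assumes n: "n \<ge> 2" and x: "x \<in> carrier (dihedral n)"
  shows "x \<in> reflections n \<longleftrightarrow> fst x = -1"
proof -
  interpret group "dihedral n"
    using n by (intro group_dihedral) simp
  have r: "dihedral_r \<in> carrier (dihedral n)"
    using n by (auto simp: dihedral_def dihedral_r_def)
  have pow: "(1, int k) \<in> rotations n" if "k < n" for k
    using that
  proof (induction k)
    case 0
    then show ?case
      using generate.one[of "dihedral n" "{dihedral_r}"] by (simp add: rotations_def dihedral_def)
  next
    case (Suc k)
    then have "(1, int k) \<otimes>\<^bsub>dihedral n\<^esub> dihedral_r \<in> rotations n"
      unfolding rotations_def by (intro generate.eng[OF _ generate.incl]) auto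
    with Suc.prems show ?case
      by (simp add: dihedral_def dihedral_r_def add.commute)
  qed
  have fst_rot: "fst y = 1" if "y \<in> rotations n" for y
  proof -
    have sub: "subgroup {y \<in> carrier (dihedral n). fst y = 1} (dihedral n)"
    proof (rule subgroupI)
      fix y assume "y \<in> {y \<in> carrier (dihedral n). fst y = 1}"
      then show "inv\<^bsub>dihedral n\<^esub> y \<in> {y \<in> carrier (dihedral n). fst y = 1}"
        using n dihedral_inv[of n 1 "snd y"] inv_closed[of y] by (cases y) auto
    qed (use n r in \<open>auto simp: dihedral_def dihedral_r_def split: prod.splits\<close>)
    show ?thesis
      using that r generate_subgroup_incl[OF _ sub, of "{dihedral_r}"]
      by (auto simp: rotations_def dihedral_r_def)
  qed
  have "x \<in> rotations n" if "fst x = 1"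
    using x that pow[of "nat (snd x)"] by (cases x) (auto simp: dihedral_def)
  then show ?thesis
    using x fst_rot[of x] by (cases x) (auto simp: reflections_def dihedral_def)
qed

lemma cubic_out_arcs:
  assumes "embedded_graph G arev rot" "cubic G" "a \<in> arcs G"
  shows "out_arcs G (tail G a) = {a, rot a, rot (rot a)}"
    and "rot a \<noteq> a" "rot (rot a) \<noteq> a" "rot (rot a) \<noteq> rot a"
proof -
  interpret embedded_graph G arev rot by fact
  let ?S = "out_arcs G (tail G a)"
  have cyc: "cyclic_on rot ?S"
    using assms(3) by (intro rot_cyclic) auto
  then have S: "?S = orbit rot b" "rot b \<in> ?S" if "b \<in> ?S" for b
    using that cyclic_on_inI[OF cyc] by (simp_all only: cyclic_on_alldef)
  have card: "card ?S = 3"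
    using assms(2,3) by (auto simp: cubic_def out_degree_def)
  have a: "a \<in> ?S"
    using assms(3) by simp
  \<comment> \<open>A coincidence among \<open>a\<close>, \<open>rot a\<close> and
    \<open>rot (rot a)\<close> would give a \<open>rot\<close>-closed set of at most two darts
    containing the whole orbit.\<close>
  have small: "\<not> ?S \<subseteq> {b, c}" for b c
    using card card_mono[of "{b, c}" ?S] by (auto simp: card_insert_if split: if_splits)
  have closed: "?S \<subseteq> T" if "rot b \<in> T" "\<And>t. t \<in> T \<Longrightarrow> rot t \<in> T" "b \<in> ?S" for T b
  proof -
    have "orbit rot b \<subseteq> T"
    proof
      fix t assume "t \<in> orbit rot b"
      then show "t \<in> T"
        by induction (use that in auto)
    qed
    then show ?thesis
      using S(1)[OF that(3)] by simp
  qed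
  show 1: "rot a \<noteq> a"
    using closed[of a "{a, a}"] small a by auto
  show 2: "rot (rot a) \<noteq> a"
    using closed[of a "{a, rot a}"] small a by auto
  show 3: "rot (rot a) \<noteq> rot a"
    using closed[of a "{rot a, rot a}"] small a by auto
  have "{a, rot a, rot (rot a)} \<subseteq> ?S"
    using S(2)[OF a] S(2)[OF S(2)[OF a]] a by blast
  then show "?S = {a, rot a, rot (rot a)}"
    using card 1 2 3 by (intro card_subset_eq [symmetric]) auto
qed

theorem theorem4p3:
  fixes G :: "('a, 'b) pre_digraph"
    and arev rot :: "'b \<Rightarrow> 'b"
    and ori :: "'b set"
    and f :: "'b set \<Rightarrow> int \<times> int"
    and n :: nat
  assumes "n \<ge> 3"
    and "embedded_graph G arev rot"
    and "cubic G"
    and "orientation G arev ori"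
    and "group_flow (dihedral n) G arev rot ori f"
    and "nowhere_identity (dihedral n) G arev f"
    and "\<And>H. reflection_cycle n G arev f H \<Longrightarrow>
           nonzero_cycle arev f H \<and> contractible_cycle G arev rot H"
  shows "has_nowhere_zero_flow G arev n"
proof -
  note n = assms(1) and graph = assms(2) and flow = assms(5)
  interpret embedded_graph G arev rot by fact
  define R where "R = reflection_subgraph n G arev f"
  have "bidirected_digraph G arev" "fin_digraph G"
    by unfold_locales
  obtain x :: "'b \<Rightarrow> int" where x: "\<And>a. a \<in> arcs G \<Longrightarrow> x (rot (arev a)) = x a"
    "\<And>a. a \<in> arcs G \<Longrightarrow> odd (x (arev a) - x a) \<longleftrightarrow> a \<in> arcs R"
    using reflection_colouring[OF graph, of n f] assms(7) unfolding R_def by metis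
  \<comment> \<open>The sign -1 marks the faces on which \<open>s\<close> is applied.\<close>
  define \<eta> :: "'b \<Rightarrow> int" where "\<eta> a = (if even (x a) then 1 else -1)" for a
  have \<eta>_sign: "\<eta> a \<in> {1, -1}" for a
    by (auto simp: \<eta>_def)
  define F where "F a = f (dart_edge arev a)" for a
  have F: "F a \<in> carrier (dihedral n)" "F (arev a) = F a" if "a \<in> arcs G" for a
    using flow that
    by (auto simp: F_def group_flow_def edges_def dart_edge_def insert_commute)
  have F_R: "fst (F a) = - 1 \<longleftrightarrow> a \<in> arcs R" if "a \<in> arcs G" for a
    using mem_reflections_iff[OF _ F(1)[OF that]] n that
    by (simp add: F_def R_def)
  have F_sign: "fst (F a) = \<eta> a * \<eta> (arev a)" if "a \<in> arcs G" for a
    using F(1)[OF that] F_R[OF that] x(2)[OF that] by (auto simp: \<eta>_def dihedral_def)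
  \<comment> \<open>Translation part zero leaves only the identity and \<open>s\<close>, excluded by
    \<open>nowhere_identity\<close> and by the non-zero cycles respectively.\<close>
  have F_nz: "snd (F a) \<noteq> 0" if a: "a \<in> arcs G" for a
  proof
    assume "snd (F a) = 0"
    then consider "F a = (1, 0)" | "F a = (-1, 0)"
      using F(1)[OF a] by (cases "F a") (auto simp: dihedral_def)
    then show False
    proof cases
      case 1
      with assms(6) a show False
        by (auto simp: F_def nowhere_identity_def edges_def dihedral_def)
    next
      case 2
      then have "a \<in> arcs R"
        using F_R[OF a] by simp
      note refl = reflection_cycle_reachable[OF graph this[unfolded R_def], folded R_def]
      interpret R: wf_digraph R
        by (rule refl(2))
      have R: "tail R = tail G" "head R = head G"
        by (auto simp: R_def)
      have "tail R a \<rightarrow>\<^sup>*\<^bsub>R\<^esub> head R a" "tail R a \<rightarrow>\<^sup>*\<^bsub>R\<^esub> tail R a"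
        using \<open>a \<in> arcs R\<close> by (auto intro: R.in_arcs_imp_in_arcs_ends)
      then have "dart_edge arev a \<in> edges (R \<restriction> {v. tail G a \<rightarrow>\<^sup>*\<^bsub>R\<^esub> v}) arev"
        using \<open>a \<in> arcs R\<close> by (simp add: edges_def R)
      with assms(7)[OF refl(1)] 2 show False
        by (auto simp: nonzero_cycle_def F_def dihedral_s_def)
    qed
  qed
  define D where "D = dart_value (dihedral n) arev ori f"
  have D: "D a = (if a \<in> ori then (fst (F a), (- fst (F a) * snd (F a)) mod int n) else F a)"
    if "a \<in> arcs G" for a
    using dihedral_inv[of n "fst (F a)" "snd (F a)"] F(1)[OF that] n
    by (auto simp: D_def dart_value_def simp flip: F_def)
  have D_sign: "fst (D a) = \<eta> a * \<eta> (arev a)" if "a \<in> arcs G" for a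
    using D[OF that] F_sign[OF that] by simp
  \<comment> \<open>The translation part of
    \<open>(\<eta> a, 0) * D a * (\<eta> (arev a), 0)\<close>, the dart value modified by the signs
    of the two adjacent faces; by \<open>D_sign\<close> this product is a rotation.\<close>
  define z where "z a = \<eta> a * snd (D a)" for a
  have \<eta>_rot: "\<eta> (rot a) = \<eta> (arev a)" if "a \<in> arcs G" for a
    using x(1)[of "arev a"] that by (simp add: \<eta>_def)
  have z_rev: "int n dvd z (arev a) + z a" if a: "a \<in> arcs G" for a
  proof -
    let ?d = "fst (F a)" and ?b = "snd (F a)"
    have "(a \<in> ori) \<noteq> (arev a \<in> ori)"
      using assms(4) a unfolding orientation_def by blast
    then have "z (arev a) + z a = \<eta> (arev a) * ((- ?d * ?b) mod int n) + \<eta> a * ?b \<or>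
        z (arev a) + z a = \<eta> (arev a) * ?b + \<eta> a * ((- ?d * ?b) mod int n)"
      using D[OF a] D[of "arev a"] F(2)[OF a] a by (auto simp: z_def)
    moreover have "(\<eta> (arev a) * ((- ?d * ?b) mod int n) + \<eta> a * ?b) mod int n = 0"
      "(\<eta> (arev a) * ?b + \<eta> a * ((- ?d * ?b) mod int n)) mod int n = 0"
    proof -
      \<comment> \<open>Inverting turns the translation \<open>b\<close> into
        \<open>- d * b\<close>; since \<open>d\<close> is the product of the two face signs, the
        contributions cancel.\<close>
      have "\<eta> (arev a) * (- ?d * ?b) + \<eta> a * ?b = 0" "\<eta> (arev a) * ?b + \<eta> a * (- ?d * ?b) = 0"
        using F_sign[OF a] \<eta>_sign[of a] \<eta>_sign[of "arev a"] by auto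
      then show "(\<eta> (arev a) * ((- ?d * ?b) mod int n) + \<eta> a * ?b) mod int n = 0"
        "(\<eta> (arev a) * ?b + \<eta> a * ((- ?d * ?b) mod int n)) mod int n = 0"
        by (metis mod_0 mod_add_left_eq mod_add_right_eq mod_mult_right_eq)+
    qed
    ultimately show ?thesis
      unfolding dvd_eq_mod_eq_0 by metis
  qed
  have z_nz: "\<not> int n dvd z a" if a: "a \<in> arcs G" for a
  proof
    assume "int n dvd z a"
    then have "int n dvd snd (D a)"
      using \<eta>_sign[of a] by (auto simp: z_def)
    then have "int n dvd snd (F a)"
      using D[OF a] F(1)[OF a] by (auto simp: dihedral_def dvd_mod_iff split: if_splits)
    with F(1)[OF a] F_nz[OF a] show False
      by (auto simp: dihedral_def dest: zdvd_imp_le)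
  qed
  have z_cons: "int n dvd (\<Sum>a\<in>out_arcs G v. z a)" if v: "v \<in> verts G" for v
  proof -
    have "out_degree G v = 3"
      using assms(3) v by (simp add: cubic_def)
    then obtain a where a: "a \<in> out_arcs G v"
      unfolding out_degree_def by (metis card.empty all_not_in_conv zero_neq_numeral)
    then have a_G: "a \<in> arcs G" "tail G a = v"
      by auto
    note out = cubic_out_arcs[OF graph assms(3) a_G(1), unfolded a_G(2)]
    have rot_G: "rot a \<in> arcs G" "rot (rot a) \<in> arcs G"
    proof -
      have "{rot a, rot (rot a)} \<subseteq> out_arcs G v"
        unfolding out(1) by blast
      then show "rot a \<in> arcs G" "rot (rot a) \<in> arcs G"
        by auto
    qed
    let ?d1 = "fst (D a)" and ?d2 = "fst (D (rot a))"
    let ?t1 = "snd (D a)" and ?t2 = "snd (D (rot a))" and ?t3 = "snd (D (rot (rot a)))"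
    have "foldr (mult (dihedral n)) (map (\<lambda>k. D ((rot ^^ k) a)) [0..<3]) \<one>\<^bsub>dihedral n\<^esub> =
        \<one>\<^bsub>dihedral n\<^esub>"
      using flow v a \<open>out_degree G v = 3\<close> unfolding group_flow_def D_def by metis
    then have "(?t1 + ?d1 * ((?t2 + ?d2 * (?t3 mod int n)) mod int n)) mod int n = 0"
      by (simp add: numeral_3_eq_3 dihedral_def split_beta add.commute)
    moreover have "(t + d * (u mod m)) mod m = (t + d * u) mod m" for t d u m :: int
      by (metis mod_add_right_eq mod_mult_right_eq)
    ultimately have "int n dvd ?t1 + ?d1 * (?t2 + ?d2 * ?t3)"
      by (simp only: dvd_eq_mod_eq_0)
    \<comment> \<open>By \<open>\<eta>_rot\<close> the second face of a dart is the first face of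
      the next one. Hence the signs telescope around the vertex, and the twisted sum becomes
      Kirchhoff's law for \<open>z\<close>.\<close>
    then have "int n dvd \<eta> a * (?t1 + ?d1 * (?t2 + ?d2 * ?t3))"
      by (rule dvd_mult)
    also have "\<eta> a * (?t1 + ?d1 * (?t2 + ?d2 * ?t3)) = z a + z (rot a) + z (rot (rot a))"
    proof -
      have "?d1 = \<eta> a * \<eta> (rot a)" "?d2 = \<eta> (rot a) * \<eta> (rot (rot a))"
        using D_sign \<eta>_rot a_G rot_G by simp_all
      then show ?thesis
        using \<eta>_sign[of a] \<eta>_sign[of "rot a"] by (auto simp: z_def)
    qed
    also have "\<dots> = (\<Sum>a\<in>out_arcs G v. z a)"
      using out by simp
    finally show ?thesis .
  qed
  obtain y where y: "\<And>a. a \<in> arcs G \<Longrightarrow> y (arev a) = - y a"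
    "\<And>a. a \<in> arcs G \<Longrightarrow> \<bar>y a\<bar> < int n" "\<And>a. a \<in> arcs G \<Longrightarrow> int n dvd y a - z a"
    "\<And>v. v \<in> verts G \<Longrightarrow> (\<Sum>a\<in>out_arcs G v. y a) = 0"
    using modular_flow_imp_integer_flow[OF \<open>bidirected_digraph G arev\<close> \<open>fin_digraph G\<close> _ assms(4) z_rev z_cons] n
    by (metis (no_types, lifting) of_nat_0_less_iff less_le_trans zero_less_numeral)
  have y_nz: "y a \<noteq> 0" if "a \<in> arcs G" for a
    using y(3)[OF that] z_nz[OF that] by auto
  show ?thesis
    by (rule integer_flow_imp_nowhere_zero_flow[OF \<open>bidirected_digraph G arev\<close> \<open>fin_digraph G\<close>
          assms(4) y(1,2) y_nz y(4)])
qed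

end
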